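(* For all fixed integers $s\ge1$ and $k\ge0$, as formal power series in $y$, $$H_k^{(s)}(y)=\sum_{i=0}^{k}\frac{(-1)^i}{i!}\,y^{i-1}\,\frac{d^i}{dy^i}\Bigl(y\,G_{k-i}^{(s)}(y)\Bigr).$$
   Context: For integers $d\ge2$ and $s\ge1$ let $$\mathcal P_d^{(s)}=\{x=(x_1,\dots,x_d)\in\mathbb R_{\ge0}^d:\ x_i+x_{i+1}\le s+\delta_i,\ 1\le i\le d-1\},$$ where $\delta_i=0$ for $i$ odd and $\delta_i=1$ for $i$ even; this is a lattice polytope. By convention $\mathcal P_0^{(s)}=\{0\}$ and $\mathcal P_1^{(s)}=[0,s]$. For $d\ge0$, $m\ge0$ let $L_d^{(s)}(m):=\#(m\mathcal P_d^{(s)}\cap\mathbb Z^d)$; in particular $L_0^{(s)}(m)=1$ and $L_1^{(s)}(m)=sm+1$, and $L_d^{(s)}(0)=1$. The $h^*$-polynomial $h_d^{(s)}(z)=\sum_{k=0}^d h_{d,k}^{(s)}z^k$ is defined by $$\sum_{m\ge0}L_d^{(s)}(m)z^m=\frac{h_d^{(s)}(z)}{(1-z)^{d+1}},$$ and $h_{d,k}^{(s)}:=0$ for $k>d$. Define $$G_m^{(s)}(y):=\sum_{d\ge0}L_d^{(s)}(m)\,y^d,\qquad H_k^{(s)}(y):=\sum_{d\ge0}h_{d,k}^{(s)}\,y^d.$$ *)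

theory Defs
  imports Complex_Main "HOL-Computational_Algebra.Computational_Algebra"
begin

definition delta :: "nat \<Rightarrow> nat" where
  "delta i = (if odd i then 0 else 1)"

text \<open>
  Since the dimension \<open>d\<close> is summed over below, a point of \<open>d\<close>-dimensional real space is
  encoded as a function \<open>nat \<Rightarrow> real\<close> with coordinates at the indices \<open>1, \<dots>, d\<close> and value
  \<open>0\<close> at all other indices.
  With this encoding the general inequalities already give \<open>{0}\<close> for \<open>d = 0\<close>; only the convention
  for \<open>d = 1\<close>, the interval \<open>[0, s]\<close>, needs a separate clause.
\<close>

definition polytope_P :: "nat \<Rightarrow> nat \<Rightarrow> (nat \<Rightarrow> real) set" where
  "polytope_P s d =
     {x. (\<forall>i. i \<notin> {1..d} \<longrightarrow> x i = 0) \<and>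
         (\<forall>i\<in>{1..d}. 0 \<le> x i) \<and>
         (\<forall>i. 1 \<le> i \<and> i < d \<longrightarrow> x i + x (i + 1) \<le> real (s + delta i)) \<and>
         (d = 1 \<longrightarrow> x 1 \<le> real s)}"

definition dilate :: "nat \<Rightarrow> (nat \<Rightarrow> real) set \<Rightarrow> (nat \<Rightarrow> real) set" where
  "dilate m P = (\<lambda>x i. real m * x i) ` P"

definition ehrhart_L :: "nat \<Rightarrow> nat \<Rightarrow> nat \<Rightarrow> nat" where
  "ehrhart_L s d m = card (dilate m (polytope_P s d) \<inter> {x. \<forall>i. x i \<in> \<int>})"

text \<open>
  The polynomial below is unique because \<open>(1 - z) ^ (d + 1)\<close> is a unit among power series; it exists by
  Ehrhart's theorem, \<open>polytope_P s d\<close> being a lattice polytope.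
\<close>

definition hstar_poly :: "nat \<Rightarrow> nat \<Rightarrow> rat poly" where
  "hstar_poly s d =
     (THE h. degree h \<le> d \<and>
        Abs_fps (\<lambda>m. of_nat (ehrhart_L s d m)) = fps_of_poly h / (1 - fps_X) ^ (d + 1))"

definition hstar :: "nat \<Rightarrow> nat \<Rightarrow> nat \<Rightarrow> rat" where
  "hstar s d k = coeff (hstar_poly s d) k"

definition G_series :: "nat \<Rightarrow> nat \<Rightarrow> rat fps" where
  "G_series s m = Abs_fps (\<lambda>d. of_nat (ehrhart_L s d m))"

definition H_series :: "nat \<Rightarrow> nat \<Rightarrow> rat fps" where
  "H_series s k = Abs_fps (\<lambda>d. hstar s d k)"

end

theory Submission imports Defs begin

text \<open>
  Comparing coefficients of \<open>y ^ d\<close>, the operator \<open>y ^ (i - 1) / i! * (d/dy) ^ i\<close> applied to \<open>y * G\<close>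
  multiplies the coefficient of \<open>y ^ d\<close> in \<open>G\<close> by \<open>Suc d choose i\<close>
  (\<open>scaled_iterated_deriv\<close>). So the identity says
  \<open>h_k = (\<Sum>i\<le>k. (-1) ^ i * (Suc d choose i) * L_d (k - i))\<close>, which is the convolution of
  \<open>(1 - z) ^ (d + 1)\<close> with the Ehrhart series. The substance is that the numerator of that
  series really is a polynomial of degree at most \<open>d\<close>; only then does the definite description
  \<open>hstar_poly\<close> denote it. For this, \<open>L_d\<close> has to be a polynomial of degree at most \<open>d\<close> on all
  of \<open>\<nat>\<close>, including \<open>0\<close> (\<open>ehrhart_L_polynomial\<close>).

  Polynomiality follows from a transfer argument instead of general Ehrhart theory. Let
  \<open>A_d (m, X)\<close> be the number of lattice points of the \<open>m\<close>-th dilate whose last coordinate is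
  at most \<open>X\<close>, that coordinate being otherwise nonnegative and linked by one inequality to its
  predecessor. Splitting by the value of the last coordinate gives
  \<open>A_(d+1) (m, X) = (\<Sum>y\<le>min X (m * c). A_d (m, m * c - y))\<close> with \<open>c = s + delta d\<close>.
  The functions \<open>A_d\<close> are in general not polynomial in \<open>X\<close>, but on each interval
  \<open>[m * j, m * (j + 1)]\<close> they agree with a polynomial in \<open>m\<close> and \<open>X - m * j\<close> of total degree
  at most \<open>d\<close>: the reflection \<open>y \<mapsto> m * c - y\<close> permutes the intervals inside \<open>[0, m * c]\<close>, and summation raises
  the degree by one (\<open>piecewise_bipoly_reflected_sum\<close>). Since \<open>L_d (m)\<close> is a value of \<open>A_d\<close>
  at a multiple of \<open>m\<close>, it is a polynomial in \<open>m\<close> alone.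
\<close>

section \<open>Bivariate polynomial functions of bounded total degree\<close>

text \<open>
  The monomial basis in the second variable is replaced by the binomials \<open>t gchoose b\<close>, because
  summing those over \<open>t\<close> is the hockey-stick identity; powers of \<open>t\<close> would need Faulhaber's formula.
\<close>

inductive bipoly :: "nat \<Rightarrow> ('a::field_char_0 \<Rightarrow> 'a \<Rightarrow> 'a) \<Rightarrow> bool" where
  bipoly_basis: "a + b \<le> D \<Longrightarrow> bipoly D (\<lambda>m t. c * m ^ a * (t gchoose b))"
| bipoly_add: "bipoly D f \<Longrightarrow> bipoly D g \<Longrightarrow> bipoly D (\<lambda>m t. f m t + g m t)"

lemma bipoly_mono: "bipoly D f \<Longrightarrow> D \<le> E \<Longrightarrow> bipoly E f"
  by (induction rule: bipoly.induct) (auto intro!: bipoly.intros)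

lemma bipoly_const: "bipoly D (\<lambda>m t. c)"
  using bipoly_basis[of 0 0 D c] by simp

lemma bipoly_cmult: "bipoly D f \<Longrightarrow> bipoly D (\<lambda>m t. c * f m t)"
proof (induction rule: bipoly.induct)
  case (bipoly_basis a b D c')
  then show ?case using bipoly.bipoly_basis[of a b D "c * c'"] by (simp add: mult.assoc)
next
  case (bipoly_add D f g)
  then show ?case using bipoly.bipoly_add by (simp add: distrib_left)
qed

lemma bipoly_mult_m: "bipoly D f \<Longrightarrow> bipoly (Suc D) (\<lambda>m t. m * f m t)"
proof (induction rule: bipoly.induct)
  case (bipoly_basis a b D c)
  then show ?case using bipoly.bipoly_basis[of "Suc a" b "Suc D" c] by (simp add: mult_ac)
next
  case (bipoly_add D f g)
  then show ?case using bipoly.bipoly_add by (simp add: distrib_left)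
qed

text \<open>
  The price of the binomial basis: multiplication by \<open>t\<close> is no longer a shift of the exponent but the
  expansion of \<open>t * (t gchoose b)\<close> in \<open>t gchoose b\<close> and \<open>t gchoose Suc b\<close>.
\<close>

lemma bipoly_mult_t: "bipoly D f \<Longrightarrow> bipoly (Suc D) (\<lambda>m t. t * f m t)"
proof (induction rule: bipoly.induct)
  case (bipoly_basis a b D c)
  have "bipoly (Suc D) (\<lambda>m t. (c * of_nat b) * m ^ a * (t gchoose b)
           + (c * of_nat (Suc b)) * m ^ a * (t gchoose Suc b))"
    using bipoly_basis by (intro bipoly.intros) auto
  moreover have "(c * of_nat b) * m ^ a * (t gchoose b)
           + (c * of_nat (Suc b)) * m ^ a * (t gchoose Suc b) = t * (c * m ^ a * (t gchoose b))" for m t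
  proof -
    have "t * (c * m ^ a * (t gchoose b)) = c * m ^ a * (t * (t gchoose b))"
      by (simp only: mult_ac)
    then show ?thesis by (simp only: gbinomial_mult_1 distrib_left mult.assoc mult.left_commute)
  qed
  ultimately show ?case by simp
next
  case (bipoly_add D f g)
  then show ?case using bipoly.bipoly_add by (simp add: distrib_left)
qed

lemma bipoly_mult_affine:
  assumes "bipoly D f"
  shows "bipoly (Suc D) (\<lambda>m t. (\<alpha> * m + \<beta> * t + \<gamma>) * f m t)"
  unfolding distrib_right mult.assoc
  by (intro bipoly_add bipoly_cmult bipoly_mult_m bipoly_mult_t assms)
     (rule bipoly_mono[OF assms], simp)

lemma bipoly_gchoose_linear:
  "bipoly b (\<lambda>m t. (\<alpha> * m + \<beta> * t) gchoose b)"
proof (induction b)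
  case 0
  then show ?case by (simp add: bipoly_const)
next
  case (Suc b)
  have "((\<alpha> * m + \<beta> * t) gchoose Suc b) =
        inverse (of_nat (Suc b)) * ((\<alpha> * m + \<beta> * t + (- of_nat b)) * ((\<alpha> * m + \<beta> * t) gchoose b))" for m t
  proof -
    have "of_nat (Suc b) * ((\<alpha> * m + \<beta> * t) gchoose Suc b)
      = (\<alpha> * m + \<beta> * t + (- of_nat b)) * ((\<alpha> * m + \<beta> * t) gchoose b)"
      using gbinomial_mult_1[of "\<alpha> * m + \<beta> * t" b]
      by (simp add: left_diff_distrib)
    then show ?thesis by (simp add: field_simps del: of_nat_Suc)
  qed
  then show ?case
    by (simp only:) (intro bipoly_cmult bipoly_mult_affine Suc)
qed

lemma bipoly_mult_power_m: "bipoly D f \<Longrightarrow> bipoly (a + D) (\<lambda>m t. m ^ a * f m t)"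
proof (induction a)
  case (Suc a)
  then show ?case using bipoly_mult_m by (fastforce simp: mult.assoc)
qed simp

text \<open>
  This yields the reflection \<open>t \<mapsto> m - t\<close> and the evaluations at the two interval ends
  \<open>t = 0\<close> and \<open>t = m\<close>. Each binomial in the substituted argument is a product of affine factors,
  one for each degree.
\<close>

lemma bipoly_linear_subst:
  "bipoly D f \<Longrightarrow> bipoly D (\<lambda>m t. f m (\<alpha> * m + \<beta> * t))"
proof (induction rule: bipoly.induct)
  case (bipoly_basis a b D c)
  have "bipoly (a + b) (\<lambda>m t. c * (m ^ a * ((\<alpha> * m + \<beta> * t) gchoose b)))"
    by (intro bipoly_cmult bipoly_mult_power_m bipoly_gchoose_linear)
  then show ?case using bipoly_mono bipoly_basis by (fastforce simp: mult.assoc)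
next
  case (bipoly_add D f g)
  then show ?case by (intro bipoly.bipoly_add)
qed

lemma bipoly_sum:
  "bipoly D f \<Longrightarrow>
    \<exists>g. bipoly (Suc D) g \<and> (\<forall>m n. (\<Sum>i\<le>n. f m (of_nat i)) = g m (of_nat n))"
proof (induction rule: bipoly.induct)
  case (bipoly_basis a b D c)
  let ?g = "\<lambda>m t. c * m ^ a * (t gchoose b) + c * m ^ a * (t gchoose Suc b)"
  have "bipoly (Suc D) ?g"
    using bipoly_basis by (intro bipoly.intros) auto
  moreover have "(\<Sum>i\<le>n. c * m ^ a * (of_nat i gchoose b)) = ?g m (of_nat n)" for m n
    using gbinomial_sum_up_index[of b n, where 'a = 'a]
    by (simp add: sum_distrib_left[symmetric] atLeast0AtMost gbinomial_Suc_Suc distrib_left)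
  ultimately show ?case by blast
next
  case (bipoly_add D f1 f2)
  then obtain g1 g2 where
    "bipoly (Suc D) g1" "\<forall>m n. (\<Sum>i\<le>n. f1 m (of_nat i)) = g1 m (of_nat n)"
    "bipoly (Suc D) g2" "\<forall>m n. (\<Sum>i\<le>n. f2 m (of_nat i)) = g2 m (of_nat n)"
    by blast
  then show ?case
    by (intro exI[of _ "\<lambda>m t. g1 m t + g2 m t"]) (auto intro: bipoly.bipoly_add simp: sum.distrib)
qed

lemma bipoly_at_zero:
  "bipoly D f \<Longrightarrow> \<exists>p. degree p \<le> D \<and> (\<forall>m. f m 0 = poly p m)"
proof (induction rule: bipoly.induct)
  case (bipoly_basis a b D c)
  show ?case
    by (rule exI[of _ "monom (c * (0 gchoose b)) a"])
       (use bipoly_basis in \<open>auto simp: poly_monom intro: order.trans[OF degree_monom_le]\<close>)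
next
  case (bipoly_add D f g)
  then obtain p q where "degree p \<le> D" "\<forall>m. f m 0 = poly p m" "degree q \<le> D" "\<forall>m. g m 0 = poly q m"
    by blast
  then show ?case by (intro exI[of _ "p + q"]) (auto intro: degree_add_le)
qed

section \<open>Functions that are polynomial between consecutive multiples of the dilation factor\<close>

text \<open>
  The intervals are closed on both sides, so neighbouring pieces agree at the common multiple of \<open>m\<close>.
  This overlap is what lets a reflection map pieces to pieces without shifting the argument by one.
\<close>

definition piecewise_bipoly :: "nat \<Rightarrow> (nat \<Rightarrow> nat \<Rightarrow> 'a::field_char_0) \<Rightarrow> bool" where
  "piecewise_bipoly D f \<longleftrightarrow>
    (\<forall>j. \<exists>p. bipoly D p \<and> (\<forall>m t. t \<le> m \<longrightarrow> f m (m * j + t) = p (of_nat m) (of_nat t)))"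

lemma piecewise_bipoly_at_multiple:
  assumes "piecewise_bipoly D f"
  shows "\<exists>p. degree p \<le> D \<and> (\<forall>m. f m (m * j) = poly p (of_nat m))"
proof -
  obtain p where p: "bipoly D p" "\<And>m t. t \<le> m \<Longrightarrow> f m (m * j + t) = p (of_nat m) (of_nat t)"
    using assms unfolding piecewise_bipoly_def by blast
  obtain q where "degree q \<le> D" "\<forall>m. p m 0 = poly q m"
    using bipoly_at_zero[OF p(1)] by blast
  with p(2)[of 0] show ?thesis by auto
qed

text \<open>
  Write \<open>g\<close> for the sum as a function of its bound. For \<open>j < c\<close>, the value
  \<open>g m (m * j + t)\<close> is \<open>g m (m * j)\<close> plus a partial sum over the reflected piece with
  number \<open>c - j - 1\<close>; from \<open>j = c\<close> on, \<open>g\<close> is constant.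
  The induction on \<open>j\<close> alternates between the value at the left end of an interval (\<open>start\<close>)
  and the whole interval (\<open>piece\<close>), whose right end is the next left end.
\<close>

lemma piecewise_bipoly_reflected_sum:
  fixes f :: "nat \<Rightarrow> nat \<Rightarrow> 'a::field_char_0"
  assumes f: "piecewise_bipoly D f"
  shows "piecewise_bipoly (Suc D) (\<lambda>m X. \<Sum>y\<le>min X (m * c). f m (m * c - y))"
proof -
  define g where "g m X = (\<Sum>y\<le>min X (m * c). f m (m * c - y))" for m X
  define piece where "piece j \<longleftrightarrow>
    (\<exists>p. bipoly (Suc D) p \<and> (\<forall>m t. t \<le> m \<longrightarrow> g m (m * j + t) = p (of_nat m) (of_nat t)))" for j
  define start where "start j \<longleftrightarrow>
    (\<exists>v. bipoly (Suc D) v \<and> (\<forall>m. g m (m * j) = v (of_nat m) 0))" for j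
  from f obtain p where p: "\<And>j. bipoly D (p j)"
      "\<And>j m t. t \<le> m \<Longrightarrow> f m (m * j + t) = p j (of_nat m) (of_nat t)"
    unfolding piecewise_bipoly_def by metis
  have at_zero: "bipoly E (\<lambda>m t. h m 0)" if "bipoly E h" for E and h :: "'a \<Rightarrow> 'a \<Rightarrow> 'a"
    using bipoly_linear_subst[OF that, of 0 0] by simp
  have start_0: "start 0"
    unfolding start_def
  proof (intro exI conjI allI)
    show "bipoly (Suc D) (p c)" using p(1) by (rule bipoly_mono) simp
    show "g m (m * 0) = p c (of_nat m) 0" for m
      using p(2)[of 0 m c] by (simp add: g_def)
  qed
  have piece_step: "piece j" if "start j" for j
  proof -
    obtain v where v: "bipoly (Suc D) v" "\<And>m. g m (m * j) = v (of_nat m) 0"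
      using \<open>start j\<close> unfolding start_def by blast
    show ?thesis
    proof (cases "j < c")
      case False
      then have "m * c \<le> m * j" for m by simp
      then have "g m (m * j + t) = g m (m * j)" for m t
        by (simp add: g_def min_absorb2 le_trans[OF _ le_add1])
      with v(2) at_zero[OF v(1)] show ?thesis unfolding piece_def by auto
    next
      case True
      have "bipoly D (\<lambda>m t. p (c - j - 1) m (1 * m + (-1) * t))"
        using p(1) by (rule bipoly_linear_subst)
      then obtain q where q: "bipoly (Suc D) q"
        "\<And>m n. (\<Sum>i\<le>n. p (c - j - 1) m (m - of_nat i)) = q m (of_nat n)"
        using bipoly_sum by fastforce
      let ?P = "\<lambda>m t. v m 0 + ((-1) * p (c - j) m 0 + q m t)"
      have "bipoly (Suc D) ?P"
        by (intro bipoly_add bipoly_cmult at_zero v(1) q(1)) (rule bipoly_mono[OF p(1)], simp)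
      moreover have "g m (m * j + t) = ?P (of_nat m) (of_nat t)" if "t \<le> m" for m t
      proof -
        obtain e where e: "c = Suc (j + e)" using True less_iff_Suc_add by auto
        have le: "m * j + t \<le> m * c" using that by (simp add: e algebra_simps)
        have "{..m * j + t} = {..m * j} \<union> {m * j<..m * j + t}"
             "{..m * j} \<inter> {m * j<..m * j + t} = {}" by auto
        then have "g m (m * j + t) = g m (m * j) + (\<Sum>y\<in>{m * j<..m * j + t}. f m (m * c - y))"
          using le add_leD1[OF le] by (simp add: g_def min_absorb1 sum.union_disjoint del: le_add1)
        also have "(\<Sum>y\<in>{m * j<..m * j + t}. f m (m * c - y)) = (\<Sum>i\<in>{0<..t}. f m (m * c - (m * j + i)))"
          by (rule sum.reindex_bij_witness[of _ "\<lambda>i. m * j + i" "\<lambda>y. y - m * j"]) auto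
        \<comment> \<open>The term \<open>i = 0\<close> is already counted in \<open>g m (m * j)\<close>; it is added so that the sum over
          the reflected piece starts at \<open>0\<close>, and subtracted again.\<close>
        also have "\<dots> = (\<Sum>i\<le>t. f m (m * c - (m * j + i))) - f m (m * c - m * j)"
        proof -
          have "{..t} = insert 0 {0<..t}" by auto
          then show ?thesis by simp
        qed
        also have "(\<Sum>i\<le>t. f m (m * c - (m * j + i))) = q (of_nat m) (of_nat t)"
          unfolding q(2)[symmetric]
        proof (rule sum.cong)
          fix i assume "i \<in> {..t}"
          with that have "i \<le> m" by simp
          then have "m * c - (m * j + i) = m * (c - j - 1) + (m - i)"
            by (simp add: e algebra_simps)
          with \<open>i \<le> m\<close> show "f m (m * c - (m * j + i)) = p (c - j - 1) (of_nat m) (of_nat m - of_nat i)"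
            using p(2)[of "m - i" m "c - j - 1"] by (simp add: of_nat_diff)
        qed simp
        also have "f m (m * c - m * j) = p (c - j) (of_nat m) 0"
          using p(2)[of 0 m "c - j"] by (simp add: diff_mult_distrib2)
        finally show ?thesis by (simp add: v(2))
      qed
      ultimately show ?thesis unfolding piece_def by blast
    qed
  qed
  have start_step: "start (Suc j)" if "piece j" for j
  proof -
    obtain q where q: "bipoly (Suc D) q"
      "\<And>m t. t \<le> m \<Longrightarrow> g m (m * j + t) = q (of_nat m) (of_nat t)"
      using \<open>piece j\<close> unfolding piece_def by blast
    have "bipoly (Suc D) (\<lambda>m t. q m (1 * m + 0 * t))"
      using q(1) by (rule bipoly_linear_subst)
    moreover have "g m (m * Suc j) = q (of_nat m) (1 * of_nat m + 0 * 0)" for m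
      using q(2)[of m m] by (simp add: add.commute)
    ultimately show ?thesis unfolding start_def by blast
  qed
  have "start j" for j
    by (induction j) (use start_0 piece_step start_step in blast)+
  then have "piece j" for j using piece_step by blast
  then show ?thesis unfolding piecewise_bipoly_def piece_def g_def by blast
qed

section \<open>Counting the lattice points one coordinate at a time\<close>

text \<open>
  Bounding the last coordinate by a separate parameter \<open>X\<close> makes the family closed under removal of
  the last coordinate: fixing \<open>x (Suc d) = y\<close> turns the inequality
  \<open>x d + x (Suc d) \<le> c d\<close> into the bound \<open>c d - y\<close> for \<open>x d\<close>.
\<close>

definition chain_points :: "(nat \<Rightarrow> nat) \<Rightarrow> nat \<Rightarrow> nat \<Rightarrow> (nat \<Rightarrow> nat) set" where
  "chain_points c d X =
    {x. (\<forall>i. i \<notin> {1..d} \<longrightarrow> x i = 0) \<and> (\<forall>i. 1 \<le> i \<and> i < d \<longrightarrow> x i + x (i + 1) \<le> c i) \<and> x d \<le> X}"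

lemma chain_points_1: "chain_points c 1 X = (\<lambda>y. (\<lambda>_. 0)(1 := y)) ` {..X}"
proof (intro equalityI subsetI)
  fix x assume "x \<in> chain_points c 1 X"
  then have "x = (\<lambda>_. 0)(1 := x 1)" "x 1 \<le> X" by (auto simp: chain_points_def fun_eq_iff)
  then show "x \<in> (\<lambda>y. (\<lambda>_. 0)(1 := y)) ` {..X}" by blast
qed (auto simp: chain_points_def)

lemma card_chain_points_1: "finite (chain_points c 1 X)" "card (chain_points c 1 X) = X + 1"
proof -
  have "inj_on (\<lambda>y. (\<lambda>_. 0 :: nat)(1 :: nat := y)) {..X}"
    by (rule inj_onI) (metis fun_upd_same)
  then show "card (chain_points c 1 X) = X + 1"
    unfolding chain_points_1 by (simp add: card_image)
  show "finite (chain_points c 1 X)" unfolding chain_points_1 by simp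
qed

lemma chain_points_Suc:
  assumes "d \<ge> 1"
  shows "chain_points c (Suc d) X =
    (\<Union>y\<le>min X (c d). (\<lambda>x. x(Suc d := y)) ` chain_points c d (c d - y))"
proof (intro equalityI subsetI)
  fix x assume x: "x \<in> chain_points c (Suc d) X"
  then have s: "x d + x (Suc d) \<le> c d" using assms by (auto simp: chain_points_def)
  let ?x = "x(Suc d := 0)"
  have "?x \<in> chain_points c d (c d - x (Suc d))"
    using x s by (auto simp: chain_points_def)
  moreover have "x = ?x(Suc d := x (Suc d))" by simp
  moreover have "x (Suc d) \<in> {..min X (c d)}" using x s by (auto simp: chain_points_def)
  ultimately show "x \<in> (\<Union>y\<le>min X (c d). (\<lambda>x. x(Suc d := y)) ` chain_points c d (c d - y))"
    by blast
next
  fix x assume "x \<in> (\<Union>y\<le>min X (c d). (\<lambda>x. x(Suc d := y)) ` chain_points c d (c d - y))"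
  then obtain y x' where y: "y \<le> X" "y \<le> c d" "x = x'(Suc d := y)" and x': "x' \<in> chain_points c d (c d - y)"
    by auto
  have "x i + x (i + 1) \<le> c i" if "1 \<le> i" "i < Suc d" for i
    using x' y that by (cases "i = d") (auto simp: chain_points_def)
  with x' y show "x \<in> chain_points c (Suc d) X"
    by (auto simp: chain_points_def)
qed

lemma inj_on_upd_chain_points: "inj_on (\<lambda>x. x(Suc d := y)) (chain_points c d Z)"
proof (rule inj_onI)
  fix x x' assume "x \<in> chain_points c d Z" "x' \<in> chain_points c d Z"
    and eq: "x(Suc d := y) = x'(Suc d := y)"
  then have "x (Suc d) = x' (Suc d)" by (auto simp: chain_points_def)
  with eq show "x = x'" by (metis fun_upd_triv fun_upd_upd)
qed

lemma finite_chain_points: "d \<ge> 1 \<Longrightarrow> finite (chain_points c d X)"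
proof (induction d arbitrary: X rule: dec_induct)
  case base
  then show ?case by (rule card_chain_points_1)
next
  case (step d)
  then show ?case by (simp add: chain_points_Suc)
qed

lemma card_chain_points_Suc:
  assumes "d \<ge> 1"
  shows "card (chain_points c (Suc d) X) = (\<Sum>y\<le>min X (c d). card (chain_points c d (c d - y)))"
proof -
  have "card (chain_points c (Suc d) X) =
      (\<Sum>y\<le>min X (c d). card ((\<lambda>x. x(Suc d := y)) ` chain_points c d (c d - y)))"
    unfolding chain_points_Suc[OF assms]
  proof (rule card_UN_disjoint)
    show "\<forall>y\<in>{..min X (c d)}. finite ((\<lambda>x. x(Suc d := y)) ` chain_points c d (c d - y))"
      using finite_chain_points[OF assms] by blast
    show "\<forall>y\<in>{..min X (c d)}. \<forall>z\<in>{..min X (c d)}. y \<noteq> z \<longrightarrow>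
      (\<lambda>x. x(Suc d := y)) ` chain_points c d (c d - y) \<inter>
      (\<lambda>x. x(Suc d := z)) ` chain_points c d (c d - z) = {}"
      by (auto dest: fun_cong[of _ _ "Suc d"])
  qed simp
  also have "\<dots> = (\<Sum>y\<le>min X (c d). card (chain_points c d (c d - y)))"
    by (simp add: card_image inj_on_upd_chain_points)
  finally show ?thesis .
qed

lemma piecewise_bipoly_card_chain_points:
  "d \<ge> 1 \<Longrightarrow>
    piecewise_bipoly d (\<lambda>m X. of_nat (card (chain_points (\<lambda>i. m * c i) d X)) :: 'a::field_char_0)"
proof (induction d rule: dec_induct)
  case base
  have "\<exists>p. bipoly 1 p \<and> (\<forall>m t. t \<le> m \<longrightarrow>
      (of_nat (card (chain_points (\<lambda>i. m * c i) 1 (m * j + t))) :: 'a) = p (of_nat m) (of_nat t))" for j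
  proof (intro exI conjI allI impI)
    show "bipoly 1 (\<lambda>m t. (of_nat j * m + 1 * t + 1) * 1 :: 'a)"
      by (rule bipoly_mult_affine[OF bipoly_const, of 0, simplified One_nat_def[symmetric]])
  qed (use card_chain_points_1[of "\<lambda>i. _ * c i"] in \<open>simp add: mult.commute\<close>)
  then show ?case unfolding piecewise_bipoly_def by blast
next
  case (step d)
  then show ?case
    using piecewise_bipoly_reflected_sum[OF step.IH, of "c d"]
    by (simp add: card_chain_points_Suc)
qed

text \<open>
  For \<open>d \<ge> 2\<close> the inequality \<open>x (d - 1) + x d \<le> m * (s + delta (d - 1))\<close> already bounds \<open>x d\<close>
  by its right-hand side, so that value of \<open>X\<close> imposes no further condition; for \<open>d = 1\<close> the bound is the convention
  \<open>[0, s]\<close>. The case \<open>m = 0\<close> is separate since a lattice point cannot be divided by \<open>m\<close>: both sides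
  then consist of the origin.
\<close>

lemma lattice_points_dilate:
  assumes "d \<ge> 1"
  shows "dilate m (polytope_P s d) \<inter> {x. \<forall>i. x i \<in> \<int>} =
    (\<lambda>x i. real (x i)) ` chain_points (\<lambda>i. m * (s + delta i)) d
       (m * (if d = 1 then s else s + delta (d - 1)))"
    (is "?A = ?f ` chain_points ?c d ?X")
proof (intro equalityI subsetI)
  fix y assume y: "y \<in> ?A"
  then obtain x where x: "x \<in> polytope_P s d" and yx: "\<And>i. y i = real m * x i"
    by (auto simp: dilate_def)
  define z where "z i = nat \<lfloor>y i\<rfloor>" for i
  have nonneg: "0 \<le> x i" for i
    using x by (cases "i \<in> {1..d}") (auto simp: polytope_P_def)
  have z: "real (z i) = real m * x i" for i
    using y nonneg[of i] unfolding z_def yx by (auto simp: yx elim!: Ints_cases)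
  have bound: "z i + z (i + 1) \<le> m * (s + delta i)" if "1 \<le> i" "i < d" for i
  proof -
    have "real (z i + z (i + 1)) = real m * (x i + x (i + 1))" by (simp add: z distrib_left)
    also have "\<dots> \<le> real m * real (s + delta i)"
      using x that by (intro mult_left_mono) (auto simp: polytope_P_def)
    finally have "real (z i + z (i + 1)) \<le> real (m * (s + delta i))" by simp
    then show ?thesis unfolding of_nat_le_iff .
  qed
  have "z d \<le> ?X"
  proof (cases "d = 1")
    case True
    then have "real (z d) \<le> real m * real s"
      using x unfolding z by (intro mult_left_mono) (auto simp: polytope_P_def)
    then have "real (z d) \<le> real (m * s)" by simp
    then show ?thesis using True unfolding of_nat_le_iff by simp
  next
    case False
    with assms have "1 \<le> d - 1" "d - 1 < d" "d - 1 + 1 = d" by auto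
    with bound[of "d - 1"] have "z d \<le> m * (s + delta (d - 1))" by simp
    with False show ?thesis by simp
  qed
  moreover have "z i = 0" if "i \<notin> {1..d}" for i
    using x that z[of i] by (auto simp: polytope_P_def)
  ultimately have "z \<in> chain_points ?c d ?X"
    using bound by (auto simp: chain_points_def)
  moreover have "y = ?f z" by (simp add: fun_eq_iff z yx)
  ultimately show "y \<in> ?f ` chain_points ?c d ?X" by blast
next
  fix y assume "y \<in> ?f ` chain_points ?c d ?X"
  then obtain z where z: "z \<in> chain_points ?c d ?X" and y: "y = ?f z" by blast
  show "y \<in> ?A"
  proof (cases "m = 0")
    case True
    have "z i = 0" for i
    proof (cases "1 \<le> i \<and> i < d")
      case t: True
      then have "z i + z (i + 1) \<le> m * (s + delta i)" using z by (auto simp: chain_points_def)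
      with True show ?thesis by simp
    next
      case False
      then show ?thesis using z True by (cases "i = d") (auto simp: chain_points_def)
    qed
    moreover have "(\<lambda>_. 0) \<in> polytope_P s d" by (auto simp: polytope_P_def)
    ultimately show ?thesis using True y by (auto simp: dilate_def image_iff)
  next
    case False
    have "real (z i) / real m + real (z (i + 1)) / real m \<le> real (s + delta i)" if "1 \<le> i" "i < d" for i
    proof -
      have "real (z i + z (i + 1)) \<le> real (m * (s + delta i))"
        using z that unfolding of_nat_le_iff by (auto simp: chain_points_def)
      then show ?thesis using False by (simp add: field_simps)
    qed
    moreover have "real (z 1) / real m \<le> real s" if "d = 1"
    proof -
      have "real (z 1) \<le> real (m * s)"
        using z that unfolding of_nat_le_iff by (auto simp: chain_points_def)
      then show ?thesis using False by (simp add: field_simps)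
    qed
    ultimately have "(\<lambda>i. real (z i) / real m) \<in> polytope_P s d"
      using z by (auto simp: polytope_P_def chain_points_def)
    moreover have "y = (\<lambda>i. real m * (real (z i) / real m))" using False y by simp
    ultimately have "y \<in> dilate m (polytope_P s d)"
      unfolding dilate_def by (rule rev_image_eqI[where f = "\<lambda>x i. real m * x i"])
    then show ?thesis using y by simp
  qed
qed

lemma ehrhart_L_0: "ehrhart_L s 0 m = 1"
proof -
  have "polytope_P s 0 = {\<lambda>_. 0}" by (auto simp: polytope_P_def)
  then have "dilate m (polytope_P s 0) \<inter> {x. \<forall>i. x i \<in> \<int>} = {\<lambda>_. 0}"
    by (auto simp: dilate_def)
  then show ?thesis by (simp add: ehrhart_L_def)
qed

lemma ehrhart_L_polynomial:
  "\<exists>p. degree p \<le> d \<and> (\<forall>m. of_nat (ehrhart_L s d m) = poly p (of_nat m :: 'a::field_char_0))"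
proof (cases "d = 0")
  case True
  then show ?thesis by (intro exI[of _ 1]) (simp add: ehrhart_L_0)
next
  case False
  let ?e = "if d = 1 then s else s + delta (d - 1)"
  have "inj (\<lambda>x i. real (x i))" by (auto simp: inj_def fun_eq_iff)
  then have "ehrhart_L s d m = card (chain_points (\<lambda>i. m * (s + delta i)) d (m * ?e))" for m
    using False unfolding ehrhart_L_def
    by (subst lattice_points_dilate) (auto intro!: card_image elim: inj_on_subset)
  moreover have "piecewise_bipoly d
      (\<lambda>m X. of_nat (card (chain_points (\<lambda>i. m * (s + delta i)) d X)) :: 'a)"
    using False by (intro piecewise_bipoly_card_chain_points) simp
  from piecewise_bipoly_at_multiple[OF this, of ?e]
  have "\<exists>p. degree p \<le> d \<and> (\<forall>m. of_nat (card (chain_points (\<lambda>i. m * (s + delta i)) d (m * ?e)))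
       = poly p (of_nat m :: 'a))" .
  ultimately show ?thesis by simp
qed

section \<open>Generating functions\<close>

text \<open>
  Horner's scheme on the side of generating functions: passing from \<open>q (m)\<close> to \<open>a + m * q (m)\<close>
  means adding \<open>a / (1 - z)\<close> to \<open>z * F'(z)\<close>, where \<open>F\<close> is the series of \<open>q\<close>. Differentiating
  \<open>F = h / (1 - z) ^ (d + 1)\<close> raises the exponent of the denominator and the degree of the numerator
  by one each.
\<close>

lemma fps_polynomial_values:
  fixes p :: "'a::field_char_0 poly"
  assumes "degree p \<le> d"
  shows "\<exists>h. degree h \<le> d \<and>
    Abs_fps (\<lambda>m. poly p (of_nat m)) * (1 - fps_X) ^ (d + 1) = fps_of_poly h"
  using assms
proof (induction d arbitrary: p)
  case 0
  then obtain a where p: "p = [:a:]" using degree_eq_zeroE by blast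
  have "Abs_fps (\<lambda>m. poly p (of_nat m)) * (1 - fps_X) ^ (0 + 1) = fps_of_poly p"
    by (rule fps_ext) (simp add: p algebra_simps fps_X_mult_nth coeff_pCons split: nat.split)
  with 0 show ?case by blast
next
  case (Suc d)
  obtain a q where p: "p = pCons a q" by (cases p)
  with Suc.prems have "degree q \<le> d" by (cases "q = 0") auto
  then obtain h where h: "degree h \<le> d"
    and hq: "Abs_fps (\<lambda>m. poly q (of_nat m)) * (1 - fps_X) ^ (d + 1) = fps_of_poly h"
    using Suc.IH by blast
  define U :: "'a fps" where "U = 1 - fps_X"
  define F where "F = Abs_fps (\<lambda>m. poly q (of_nat m))"
  have U: "U = fps_of_poly [:1, -1:]" by (simp add: U_def fps_of_poly_pCons)
  have FU: "F * U ^ (d + 1) = fps_of_poly h" using hq by (simp add: F_def U_def)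
  have dU: "fps_deriv (U ^ (d + 1)) = - (of_nat (d + 1) * U ^ d)"
    using fps_deriv_power[of U "d + 1"] by (simp add: U_def fps_of_nat del: of_nat_Suc power_Suc)
  have "fps_deriv F * U ^ (d + 1) - of_nat (d + 1) * (F * U ^ d) = fps_deriv (F * U ^ (d + 1))"
    unfolding fps_deriv_mult dU by (simp add: algebra_simps)
  then have "(fps_deriv F * U ^ (d + 1) - of_nat (d + 1) * (F * U ^ d)) * U = fps_of_poly (pderiv h) * U"
    by (simp only: FU fps_of_poly_pderiv)
  moreover have "(fps_deriv F * U ^ (d + 1) - of_nat (d + 1) * (F * U ^ d)) * U
    = fps_deriv F * U ^ (d + 2) - of_nat (d + 1) * (F * U ^ (d + 1))"
    by (simp add: algebra_simps)
  ultimately have dF: "fps_deriv F * U ^ (d + 2) =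
      fps_of_poly (pderiv h) * U + of_nat (d + 1) * fps_of_poly h"
    by (simp only: FU) (simp add: algebra_simps)
  define C where "C = Abs_fps (\<lambda>_. 1 :: 'a)"
  have CU: "C * U = 1"
    by (rule fps_ext) (simp add: C_def U_def algebra_simps fps_X_mult_nth)
  have "Abs_fps (\<lambda>m. poly p (of_nat m)) = fps_const a * C + fps_X * fps_deriv F"
    by (rule fps_ext) (auto simp: p C_def F_def fps_X_mult_nth of_nat_diff)
  then have "Abs_fps (\<lambda>m. poly p (of_nat m)) * U ^ (d + 2) =
      fps_const a * (C * U) * U ^ (d + 1) + fps_X * (fps_deriv F * U ^ (d + 2))"
    by (simp add: algebra_simps)
  also have "\<dots> = fps_of_poly (smult a ([:1, -1:] ^ (d + 1))
       + [:0, 1:] * (pderiv h * [:1, -1:] + smult (of_nat (d + 1)) h))" (is "_ = fps_of_poly ?h")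
    unfolding CU dF unfolding U
    by (simp add: fps_of_poly_add fps_of_poly_mult fps_of_poly_smult fps_of_poly_power fps_of_poly_pCons fps_of_nat[symmetric]
             del: power_Suc of_nat_Suc)
  finally have "Abs_fps (\<lambda>m. poly p (of_nat m)) * (1 - fps_X) ^ (Suc d + 1) = fps_of_poly ?h"
    by (simp add: U_def)
  moreover have "degree ?h \<le> Suc d"
  proof (rule degree_add_le)
    show "degree (smult a ([:1, -1:] ^ (d + 1))) \<le> Suc d"
      using degree_power_le[of "[:1, -1 :: 'a:]" "d + 1"] by (intro order.trans[OF degree_smult_le]) simp
    have "degree (pderiv h * [:1, -1:]) \<le> d"
    proof (cases "pderiv h = 0")
      case False
      then have "degree h \<noteq> 0" by (simp add: pderiv_eq_0_iff)
      then show ?thesis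
        using degree_mult_le[of "pderiv h" "[:1, -1:]"] h by (simp add: degree_pderiv)
    qed simp
    then have "degree (pderiv h * [:1, -1:] + smult (of_nat (d + 1)) h) \<le> d"
      using h by (intro degree_add_le) (auto intro: order.trans[OF degree_smult_le])
    then show "degree ([:0, 1:] * (pderiv h * [:1, -1:] + smult (of_nat (d + 1)) h)) \<le> Suc d"
      by (intro order.trans[OF degree_mult_le]) simp
  qed
  ultimately show ?case by blast
qed

text \<open>
  The defining description of \<open>hstar_poly\<close> is met by exactly one polynomial: uniqueness holds
  because \<open>(1 - z) ^ (d + 1)\<close> is a unit, existence because \<open>L_d\<close> is a polynomial.
\<close>

lemma fps_of_poly_hstar_poly:
  "fps_of_poly (hstar_poly s d) = Abs_fps (\<lambda>m. of_nat (ehrhart_L s d m)) * (1 - fps_X) ^ (d + 1)"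
proof -
  let ?F = "Abs_fps (\<lambda>m. of_nat (ehrhart_L s d m)) :: rat fps"
  let ?V = "(1 - fps_X) ^ (d + 1) :: rat fps"
  have V0: "?V $ 0 \<noteq> 0" by (simp add: fps_power_zeroth)
  then have div_iff: "?F = fps_of_poly h / ?V \<longleftrightarrow> fps_of_poly h = ?F * ?V" for h
    using inverse_mult_eq_1[OF V0] unfolding fps_divide_unit[OF V0]
    by (auto simp only: mult.assoc mult.commute[of ?V] mult_1_right)
  obtain p where p: "degree p \<le> d" "\<forall>m. of_nat (ehrhart_L s d m) = poly p (of_nat m :: rat)"
    using ehrhart_L_polynomial by blast
  obtain h where h: "degree h \<le> d" "?F * ?V = fps_of_poly h"
    using fps_polynomial_values[OF p(1)] p(2) by auto
  have "hstar_poly s d = h"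
    unfolding hstar_poly_def div_iff
    by (rule the_equality) (use h in \<open>auto simp: fps_of_poly_eq_iff\<close>)
  with h show ?thesis by simp
qed

lemma one_minus_fps_X_power_nth:
  "((1 - fps_X) ^ n :: 'a::comm_ring_1 fps) $ k = (-1) ^ k * of_nat (n choose k)"
proof (induction n arbitrary: k)
  case 0
  then show ?case by (cases k) auto
next
  case (Suc n)
  have "((1 - fps_X) * g) $ k = g $ k - (if k = 0 then 0 else g $ (k - 1))" for g :: "'a fps"
    by (simp add: left_diff_distrib)
  then show ?case by (cases k) (simp_all add: Suc algebra_simps)
qed

lemma hstar_eq_alternating_sum:
  "hstar s d k = (\<Sum>i=0..k. (-1) ^ i * of_nat (Suc d choose i) * of_nat (ehrhart_L s d (k - i)))"
proof -
  have "hstar s d k = fps_of_poly (hstar_poly s d) $ k" by (simp add: hstar_def)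
  also have "\<dots> = ((1 - fps_X) ^ (d + 1) * Abs_fps (\<lambda>m. of_nat (ehrhart_L s d m))) $ k"
    by (simp only: fps_of_poly_hstar_poly mult.commute)
  also have "\<dots> = (\<Sum>i=0..k. (-1) ^ i * of_nat (Suc d choose i) * of_nat (ehrhart_L s d (k - i)))"
    by (simp only: fps_mult_nth one_minus_fps_X_power_nth) simp
  finally show ?thesis .
qed

lemma fps_iterated_deriv_nth:
  "(fps_deriv ^^ i) (f :: 'a::field_char_0 fps) $ n = fact (n + i) / fact n * f $ (n + i)"
proof (induction i arbitrary: n)
  case (Suc i)
  have "of_nat (Suc n) / fact (Suc n) = (1 / fact n :: 'a)"
    by (simp add: fact_Suc del: of_nat_Suc)
  then have quotient: "of_nat (Suc n) * (fact (Suc n + i) / fact (Suc n)) = (fact (n + Suc i) / fact n :: 'a)"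
    by (metis add_Suc_shift mult_1 times_divide_eq_left times_divide_eq_right mult.commute)
  have "(fps_deriv ^^ Suc i) f $ n
      = of_nat (Suc n) * (fact (Suc n + i) / fact (Suc n)) * f $ (Suc n + i)"
    by (simp add: Suc.IH del: of_nat_Suc fact_Suc)
  then show ?case by (simp only: quotient[unfolded add_Suc_shift] add_Suc_shift)
qed simp

text \<open>
  The \<open>i\<close>-th derivative sends \<open>y ^ (d + 1)\<close> to \<open>(d + 1)! / (d + 1 - i)! * y ^ (d + 1 - i)\<close>, and
  the factor \<open>y ^ (i - 1)\<close> restores the exponent \<open>d\<close>. The negative power at \<open>i = 0\<close> is harmless as
  \<open>y * G\<close> has no constant term.
\<close>

lemma scaled_iterated_deriv:
  fixes G :: "'a::field_char_0 fps"
  shows "fls_const (c / fact i) * fls_X_intpow (int i - 1) * fps_to_fls ((fps_deriv ^^ i) (fps_X * G))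
    = fps_to_fls (Abs_fps (\<lambda>d. c * of_nat (Suc d choose i) * G $ d))"
proof (rule fls_eqI)
  fix n :: int
  have lhs: "fls_nth (fls_const (c / fact i) * fls_X_intpow (int i - 1) * fps_to_fls ((fps_deriv ^^ i) (fps_X * G))) n
     = c / fact i * fls_nth (fps_to_fls ((fps_deriv ^^ i) (fps_X * G))) (n - (int i - 1))"
    by (subst mult.assoc, subst fls_X_intpow_times_conv_shift(1)) (simp add: algebra_simps)
  show "fls_nth (fls_const (c / fact i) * fls_X_intpow (int i - 1) * fps_to_fls ((fps_deriv ^^ i) (fps_X * G))) n
    = fls_nth (fps_to_fls (Abs_fps (\<lambda>d. c * of_nat (Suc d choose i) * G $ d))) n"
  proof (cases "n < int i - 1 \<or> n < 0")
    \<comment> \<open>Both sides vanish: for \<open>0 \<le> n < i - 1\<close> the binomial \<open>Suc n choose i\<close> is \<open>0\<close>, and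
      for \<open>n = -1\<close>, \<open>i = 0\<close> the constant term of \<open>y * G\<close> is.\<close>
    case True
    then show ?thesis unfolding lhs
      by (auto simp: fps_iterated_deriv_nth binomial_eq_0 nat_less_iff)
  next
    case False
    then obtain d where d: "n = int d" by (metis nonneg_int_cases not_less)
    with False have i: "i \<le> Suc d" by simp
    then have "nat (n - (int i - 1)) = Suc d - i" unfolding d by simp
    with False i show ?thesis unfolding lhs
      by (simp add: d fps_iterated_deriv_nth binomial_fact[of i "Suc d"])
  qed
qed

theorem theorem1p7:
  fixes s k :: nat
  assumes "s \<ge> 1"
  shows "fps_to_fls (H_series s k) =
    (\<Sum>i=0..k. fls_const ((- 1) ^ i / fact i) * fls_X_intpow (int i - 1) *
       fps_to_fls ((fps_deriv ^^ i) (fps_X * G_series s (k - i))))"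
proof -
  have "H_series s k = (\<Sum>i=0..k. Abs_fps (\<lambda>d. (-1) ^ i * of_nat (Suc d choose i) * G_series s (k - i) $ d))"
    by (rule fps_ext) (simp add: H_series_def G_series_def hstar_eq_alternating_sum fps_sum_nth)
  then have "fps_to_fls (H_series s k) =
      (\<Sum>i=0..k. fps_to_fls (Abs_fps (\<lambda>d. (-1) ^ i * of_nat (Suc d choose i) * G_series s (k - i) $ d)))"
    by (simp add: fls_eq_iff fls_nth_sum fps_sum_nth)
  also have "\<dots> = (\<Sum>i=0..k. fls_const ((- 1) ^ i / fact i) * fls_X_intpow (int i - 1) *
       fps_to_fls ((fps_deriv ^^ i) (fps_X * G_series s (k - i))))"
    by (simp only: scaled_iterated_deriv)
  finally show ?thesis .
qed

end
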